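(* Let $M := \mathbb{R}^{\mathbb{N}}$ be the Fréchet space of all real sequences (with the product topology), and let $N := \ell^\infty \subseteq M$ be the additive subgroup of bounded sequences. For each $k \in \mathbb{N}\cup\{\infty\}$, $N$ is not a $C^k$-initial submanifold of $M$. In particular, $N$ is not an initial Lie subgroup of the additive Lie group $\mathbb{R}^{\mathbb{N}}$.
   Context: Conventions: $\mathbb{N}=\{1,2,\ldots\}$. All locally convex spaces are real and Hausdorff. For locally convex spaces $E,F$ and open $U\subseteq E$, a map $f\colon U\to F$ is $C^k$ if it is continuous and the iterated directional derivatives $d^jf\colon U\times E^j\to F$ exist and are continuous for all integers $j\in\mathbb{N}$ with $j\le k$; "smooth" means $C^\infty$. A $C^k$-manifold is a Hausdorff space with a $C^k$-atlas of charts onto open subsets of a (possibly infinite-dimensional, arbitrary) locally convex space. A Lie group is a group with a smooth manifold structure for which the group operations are smooth; $L(G):=T_1(G)$ is its Lie algebra. Definitions: Let $k\in\mathbb{N}\cup\{\infty\}$ and $M$ be a $C^k$-manifold. A subset $N\subseteq M$ is a $C^k$-initial submanifold of $M$ if $N$ can be made a $C^k$-manifold (with some topology and atlas, modelled on some locally convex space) such that (a) the inclusion map $\lambda\colon N\to M$ is $C^k$; and (b) whenever $X$ is a $C^k$-manifold and $f\colon X\to N$ is a map such that $\lambda\circ f$ is $C^k$, then $f$ is $C^k$. Such a manifold structure is called $C^k$-initial in $M$. A subgroup $H$ of a Lie group $G$ is an initial Lie subgroup if it can be given a smooth manifold structure which makes $H$ a Lie group, is $C^k$-initial in $G$ for each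 $k\in\mathbb{N}\cup\{\infty\}$, and for which the tangent map $L(\lambda):=T_1(\lambda)\colon L(H)\to L(G)$ of the inclusion $\lambda\colon H\to G$ is injective. *)

theory Defs
  imports
    "HOL-Analysis.Analysis"
    "HOL-Algebra.Group"
    "HOL-Library.Function_Algebras"
    "HOL-Library.Extended_Nat"
begin

instantiation "fun" :: (type, real_vector) real_vector
begin

definition scaleR_fun_def: "a *\<^sub>R f = (\<lambda>x. a *\<^sub>R f x)"

instance
  by standard (simp_all add: scaleR_fun_def fun_eq_iff algebra_simps)

end


section \<open>Locally convex spaces and \<open>C\<^sup>k\<close>-maps\<close>

text \<open>
  A real Hausdorff locally convex space is given by a topology on a linear subspace (its
  \<open>topspace\<close>) of some type of class \<open>real_vector\<close>.  The topology is arbitrary; it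
  is unrelated to a topology that the type itself may carry.
\<close>

definition lc_space :: "'e::real_vector topology \<Rightarrow> bool" where
  "lc_space E \<longleftrightarrow>
     subspace (topspace E) \<and>
     continuous_map (prod_topology E E) E (\<lambda>(x, y). x + y) \<and>
     continuous_map (prod_topology euclideanreal E) E (\<lambda>(a, x). a *\<^sub>R x) \<and>
     Hausdorff_space E \<and>
     (\<forall>U. openin E U \<and> 0 \<in> U \<longrightarrow> (\<exists>V. openin E V \<and> 0 \<in> V \<and> convex V \<and> V \<subseteq> U))"

definition has_dir_deriv ::
    "'f::real_vector topology \<Rightarrow> ('e::real_vector \<Rightarrow> 'f) \<Rightarrow> 'e \<Rightarrow> 'e \<Rightarrow> 'f \<Rightarrow> bool" where
  "has_dir_deriv F f x v l \<longleftrightarrow>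
     limitin F (\<lambda>t::real. (1 / t) *\<^sub>R (f (x + t *\<^sub>R v) - f x)) l (at 0)"

definition dir_deriv ::
    "'f::real_vector topology \<Rightarrow> ('e::real_vector \<Rightarrow> 'f) \<Rightarrow> 'e \<Rightarrow> 'e \<Rightarrow> 'f" where
  "dir_deriv F f x v = (THE l. has_dir_deriv F f x v l)"

text \<open>
  \<open>iter_deriv F f j v x\<close> is \<open>d\<^sup>j f (x, v 0, \<dots>, v (j - 1))\<close>; the direction \<open>v 0\<close>
  is differentiated first.
\<close>

primrec iter_deriv ::
    "'f::real_vector topology \<Rightarrow> ('e::real_vector \<Rightarrow> 'f) \<Rightarrow> nat \<Rightarrow> (nat \<Rightarrow> 'e) \<Rightarrow> 'e \<Rightarrow> 'f" where
  "iter_deriv F f 0 v x = f x"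
| "iter_deriv F f (Suc j) v x = dir_deriv F (\<lambda>y. iter_deriv F f j v y) x (v j)"

text \<open>
  Only the values of \<open>f\<close> on the open set \<open>U\<close> matter: the difference quotients
  at a point of \<open>U\<close> are eventually formed inside \<open>U\<close>.
\<close>

definition Ck_on ::
    "enat \<Rightarrow> 'e::real_vector topology \<Rightarrow> 'f::real_vector topology \<Rightarrow> 'e set \<Rightarrow> ('e \<Rightarrow> 'f) \<Rightarrow> bool" where
  "Ck_on k E F U f \<longleftrightarrow>
     continuous_map (subtopology E U) F f \<and>
     (\<forall>j. enat (Suc j) \<le> k \<longrightarrow>
        (\<forall>x \<in> U. \<forall>v \<in> {..<Suc j} \<rightarrow>\<^sub>E topspace E. \<exists>l. has_dir_deriv F (iter_deriv F f j v) x (v j) l) \<and>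
        continuous_map
          (prod_topology (subtopology E U) (product_topology (\<lambda>_. E) {..<Suc j})) F
          (\<lambda>(x, v). iter_deriv F f (Suc j) v x))"


section \<open>Manifolds\<close>

text \<open>
  A chart is a pair of its open domain and a map that matters only on this domain.  Atlases need
  not be maximal: every atlas determines a manifold structure, and a \<open>C\<^sup>\<infinity>\<close>-atlas is also
  a \<open>C\<^sup>k\<close>-atlas for each \<open>k\<close>.
\<close>

record ('x, 'e) mfd =
  mtop :: "'x topology"
  model :: "'e topology"
  atlas :: "('x set \<times> ('x \<Rightarrow> 'e)) set"

definition Ck_manifold :: "enat \<Rightarrow> ('x, 'e::real_vector) mfd \<Rightarrow> bool" where
  "Ck_manifold k M \<longleftrightarrow>
     Hausdorff_space (mtop M) \<and>
     lc_space (model M) \<and>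
     (\<Union>(V, \<phi>) \<in> atlas M. V) = topspace (mtop M) \<and>
     (\<forall>(V, \<phi>) \<in> atlas M.
        openin (mtop M) V \<and> openin (model M) (\<phi> ` V) \<and>
        homeomorphic_map (subtopology (mtop M) V) (subtopology (model M) (\<phi> ` V)) \<phi>) \<and>
     (\<forall>(V, \<phi>) \<in> atlas M. \<forall>(W, \<psi>) \<in> atlas M.
        Ck_on k (model M) (model M) (\<phi> ` (V \<inter> W)) (\<psi> \<circ> inv_into V \<phi>))"

definition Ck_map ::
    "enat \<Rightarrow> ('x, 'e::real_vector) mfd \<Rightarrow> ('y, 'f::real_vector) mfd \<Rightarrow> ('x \<Rightarrow> 'y) \<Rightarrow> bool" where
  "Ck_map k M N f \<longleftrightarrow>
     continuous_map (mtop M) (mtop N) f \<and>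
     (\<forall>(V, \<phi>) \<in> atlas M. \<forall>(W, \<psi>) \<in> atlas N.
        Ck_on k (model M) (model N) (\<phi> ` (V \<inter> f -` W)) (\<psi> \<circ> f \<circ> inv_into V \<phi>))"

definition prod_mfd ::
    "('x, 'e::real_vector) mfd \<Rightarrow> ('y, 'f::real_vector) mfd \<Rightarrow> ('x \<times> 'y, 'e \<times> 'f) mfd" where
  "prod_mfd M N =
     \<lparr> mtop = prod_topology (mtop M) (mtop N),
       model = prod_topology (model M) (model N),
       atlas = {(V \<times> W, map_prod \<phi> \<psi>) | V \<phi> W \<psi>. (V, \<phi>) \<in> atlas M \<and> (W, \<psi>) \<in> atlas N} \<rparr>"

definition lc_space_mfd :: "'e::real_vector topology \<Rightarrow> ('e, 'e) mfd" where
  "lc_space_mfd E = \<lparr> mtop = E, model = E, atlas = {(topspace E, \<lambda>x. x)} \<rparr>"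


section \<open>Tangent spaces\<close>

text \<open>
  A tangent vector at \<open>x\<close> is a class of pairs of a chart \<open>(V, \<phi>)\<close> around \<open>x\<close> and a vector of
  the modelling space; \<open>((V, \<phi>), v)\<close> and \<open>((W, \<psi>), w)\<close> are identified if \<open>w\<close> is the
  derivative of \<open>\<psi> \<circ> \<phi>\<^sup>-\<^sup>1\<close> at \<open>\<phi> x\<close> in direction \<open>v\<close>.
\<close>

definition charts_at :: "('x, 'e) mfd \<Rightarrow> 'x \<Rightarrow> ('x set \<times> ('x \<Rightarrow> 'e)) set" where
  "charts_at M x = {c \<in> atlas M. x \<in> fst c}"

definition tangent_rel ::
    "('x, 'e::real_vector) mfd \<Rightarrow> 'x \<Rightarrow> ((('x set \<times> ('x \<Rightarrow> 'e)) \<times> 'e) rel)" where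
  "tangent_rel M x =
     {(((V, \<phi>), v), ((W, \<psi>), w)) | V \<phi> v W \<psi> w.
        (V, \<phi>) \<in> charts_at M x \<and> (W, \<psi>) \<in> charts_at M x \<and>
        v \<in> topspace (model M) \<and> w \<in> topspace (model M) \<and>
        has_dir_deriv (model M) (\<psi> \<circ> inv_into V \<phi>) (\<phi> x) v w}"

definition tangent_space ::
    "('x, 'e::real_vector) mfd \<Rightarrow> 'x \<Rightarrow> (('x set \<times> ('x \<Rightarrow> 'e)) \<times> 'e) set set" where
  "tangent_space M x = (charts_at M x \<times> topspace (model M)) // tangent_rel M x"

text \<open>
  For a \<open>C\<^sup>1\<close>-map all members of the following union are the same tangent vector
  of \<open>N\<close> at \<open>f x\<close>.
\<close>

definition tangent_map ::
    "('x, 'e::real_vector) mfd \<Rightarrow> ('y, 'f::real_vector) mfd \<Rightarrow> ('x \<Rightarrow> 'y) \<Rightarrow> 'x \<Rightarrow>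
     (('x set \<times> ('x \<Rightarrow> 'e)) \<times> 'e) set \<Rightarrow> (('y set \<times> ('y \<Rightarrow> 'f)) \<times> 'f) set" where
  "tangent_map M N f x \<xi> =
     (\<Union>((V, \<phi>), v) \<in> \<xi>. \<Union>(W, \<psi>) \<in> charts_at N (f x).
        tangent_rel N (f x) `` {((W, \<psi>), dir_deriv (model N) (\<psi> \<circ> f \<circ> inv_into V \<phi>) (\<phi> x) v)})"


section \<open>Initial submanifolds and initial Lie subgroups\<close>

text \<open>
  A definition in HOL cannot quantify over types.  The argument of type \<open>'u itself\<close> is
  the universe from which the points and the modelling vectors of the test manifolds \<open>X\<close>
  are taken.  The modelling spaces and point sets are arbitrary subsets of it, so that
  every manifold \<open>X\<close> occurs, up to isomorphism, for all sufficiently large \<open>'u\<close>; in a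
  trivial universe the condition on \<open>X\<close> would be void.  Being initial implies being initial
  relative to each universe.  The
  argument of type \<open>'e itself\<close> similarly determines the type containing the modelling space
  of the submanifold.
\<close>

definition Ck_initial_structure ::
    "'u::real_vector itself \<Rightarrow> enat \<Rightarrow> ('x, 'm::real_vector) mfd \<Rightarrow> ('x, 'e::real_vector) mfd \<Rightarrow> bool" where
  "Ck_initial_structure _ k M N \<longleftrightarrow>
     Ck_manifold k N \<and>
     topspace (mtop N) \<subseteq> topspace (mtop M) \<and>
     Ck_map k N M (\<lambda>x. x) \<and>
     (\<forall>(X :: ('u, 'u) mfd) f.
        Ck_manifold k X \<and> f \<in> topspace (mtop X) \<rightarrow> topspace (mtop N) \<and> Ck_map k X M ((\<lambda>x. x) \<circ> f)
        \<longrightarrow> Ck_map k X N f)"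

definition Ck_initial_submanifold ::
    "'u::real_vector itself \<Rightarrow> 'e::real_vector itself \<Rightarrow> enat \<Rightarrow> ('x, 'm::real_vector) mfd \<Rightarrow> 'x set \<Rightarrow> bool" where
  "Ck_initial_submanifold u _ k M N \<longleftrightarrow>
     (\<exists>S :: ('x, 'e) mfd. topspace (mtop S) = N \<and> Ck_initial_structure u k M S)"

definition Lie_group :: "'x monoid \<Rightarrow> ('x, 'e::real_vector) mfd \<Rightarrow> bool" where
  "Lie_group G M \<longleftrightarrow>
     group G \<and> Ck_manifold \<infinity> M \<and> topspace (mtop M) = carrier G \<and>
     Ck_map \<infinity> (prod_mfd M M) M (\<lambda>(x, y). x \<otimes>\<^bsub>G\<^esub> y) \<and>
     Ck_map \<infinity> M M (\<lambda>x. inv\<^bsub>G\<^esub> x)"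

definition initial_Lie_subgroup ::
    "'u::real_vector itself \<Rightarrow> 'e::real_vector itself \<Rightarrow> 'x monoid \<Rightarrow> ('x, 'm::real_vector) mfd \<Rightarrow> 'x set \<Rightarrow> bool" where
  "initial_Lie_subgroup u _ G M H \<longleftrightarrow>
     Lie_group G M \<and> subgroup H G \<and>
     (\<exists>S :: ('x, 'e) mfd.
        Lie_group (G\<lparr>carrier := H\<rparr>) S \<and>
        (\<forall>k. k \<noteq> 0 \<longrightarrow> Ck_initial_structure u k M S) \<and>
        inj_on (tangent_map S M (\<lambda>x. x) \<one>\<^bsub>G\<^esub>) (tangent_space S \<one>\<^bsub>G\<^esub>))"


section \<open>Real sequences\<close>

definition real_sequences :: "(nat \<Rightarrow> real) topology" where
  "real_sequences = product_topology (\<lambda>_. euclideanreal) UNIV"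

definition seq_mfd :: "(nat \<Rightarrow> real, nat \<Rightarrow> real) mfd" where
  "seq_mfd = lc_space_mfd real_sequences"

definition seq_group :: "(nat \<Rightarrow> real) monoid" where
  "seq_group = \<lparr> carrier = UNIV, monoid.mult = (+), one = 0 \<rparr>"

definition bounded_sequences :: "(nat \<Rightarrow> real) set" where
  "bounded_sequences = {x. bounded (range x)}"


subsection \<open>The sequence space is a Lie group and the bounded sequences form a subgroup\<close>

lemma topspace_real_sequences [simp]: "topspace real_sequences = UNIV"
  by (simp add: real_sequences_def)

lemma into_real_sequences:
  "continuous_map X real_sequences f \<longleftrightarrow> (\<forall>i. continuous_map X euclideanreal (\<lambda>x. f x i))"
  unfolding real_sequences_def by (rule continuous_map_componentwise_UNIV)

lemma lc_space_real_sequences: "lc_space real_sequences"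
  unfolding lc_space_def
proof (intro conjI allI impI)
  have c: "continuous_map real_sequences euclideanreal (\<lambda>x. x i)" for i
    unfolding real_sequences_def by (rule continuous_map_product_projection) simp
  show "subspace (topspace real_sequences)" by simp
  have c1: "continuous_map (prod_topology real_sequences real_sequences) euclideanreal (\<lambda>z. fst z i)" for i
    using continuous_map_compose[OF continuous_map_fst c] by (simp add: comp_def)
  have c2: "continuous_map (prod_topology real_sequences real_sequences) euclideanreal (\<lambda>z. snd z i)" for i
    using continuous_map_compose[OF continuous_map_snd c] by (simp add: comp_def)
  have "continuous_map (prod_topology real_sequences real_sequences) euclideanreal (\<lambda>z. fst z i + snd z i)" for i
    by (intro continuous_map_add c1 c2)
  then show "continuous_map (prod_topology real_sequences real_sequences) real_sequences (\<lambda>(x, y). x + y)"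
    by (simp add: case_prod_unfold into_real_sequences)
  have d1: "continuous_map (prod_topology euclideanreal real_sequences) euclideanreal (\<lambda>z. fst z)"
    by (rule continuous_map_fst)
  have d2: "continuous_map (prod_topology euclideanreal real_sequences) euclideanreal (\<lambda>z. snd z i)" for i
    using continuous_map_compose[OF continuous_map_snd c] by (simp add: comp_def)
  have "continuous_map (prod_topology euclideanreal real_sequences) euclideanreal (\<lambda>z. fst z * snd z i)" for i
    by (intro continuous_map_real_mult d1 d2)
  then show "continuous_map (prod_topology euclideanreal real_sequences) real_sequences (\<lambda>(a, x). a *\<^sub>R x)"
    by (simp add: case_prod_unfold into_real_sequences scaleR_fun_def)
  show "Hausdorff_space real_sequences"
    by (simp add: real_sequences_def Hausdorff_space_product_topology)
next
  fix U :: "(nat \<Rightarrow> real) set"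
  assume "openin real_sequences U \<and> 0 \<in> U"
  then obtain B where B: "finite {i \<in> UNIV. B i \<noteq> topspace euclideanreal}"
      "\<forall>i \<in> UNIV. openin euclideanreal (B i)" "0 \<in> Pi\<^sub>E UNIV B" "Pi\<^sub>E UNIV B \<subseteq> U"
    unfolding real_sequences_def openin_product_topology_alt by meson
  have "\<exists>e>0. {-e<..<e} \<subseteq> B i" for i
  proof -
    have "0 \<in> B i" using B(3) by (auto simp: PiE_iff)
    then obtain e where "e > 0" "ball 0 e \<subseteq> B i" using B(2) openE[of "B i" 0] by auto
    moreover have "ball 0 e = {-e<..<e}" by (auto simp: dist_real_def)
    ultimately show ?thesis by auto
  qed
  then obtain e where e: "\<And>i. e i > 0" "\<And>i. {-e i<..<e i} \<subseteq> B i" by metis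
  define C where "C i = (if B i = UNIV then UNIV else {-e i<..<e i})" for i
  have C: "open (C i)" "convex (C i)" "0 \<in> C i" "C i \<subseteq> B i" for i
    using e by (auto simp: C_def)
  have "finite {i. C i \<noteq> UNIV}"
    by (rule finite_subset[OF _ B(1)]) (auto simp: C_def split: if_splits)
  then have "openin real_sequences (Pi\<^sub>E UNIV C)"
    unfolding real_sequences_def by (intro product_topology_basis) (auto simp: C)
  moreover have "convex (Pi\<^sub>E UNIV C)"
    unfolding convex_def
    using C(2) by (auto simp: PiE_iff scaleR_fun_def convex_def)
  moreover have "Pi\<^sub>E UNIV C \<subseteq> U" using B(4) C(4) by (auto simp: PiE_iff subset_iff)
  moreover have "0 \<in> Pi\<^sub>E UNIV C" using C(3) by (auto simp: PiE_iff)
  ultimately show "\<exists>V. openin real_sequences V \<and> 0 \<in> V \<and> convex V \<and> V \<subseteq> U" by blast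
qed

lemma limitin_const_punctured:
  assumes "l \<in> topspace F" "\<forall>t. t \<noteq> 0 \<longrightarrow> g t = l"
  shows "limitin F g l (at (0::real))"
  using assms by (auto simp: limitin_def eventually_at intro: exI[of _ 1])

lemma Ck_on_linear:
  fixes E :: "'e::real_vector topology" and F :: "'f::real_vector topology"
  assumes H: "Hausdorff_space F" and E: "topspace E = UNIV" and F: "topspace F = UNIV"
    and L: "linear L" and c: "continuous_map E F L"
  shows "Ck_on k E F UNIV L"
proof -
  have D: "has_dir_deriv F L x v (L v)" for x v
    unfolding has_dir_deriv_def
    by (rule limitin_const_punctured)
       (auto simp: F linear_add[OF L] linear_cmul[OF L])
  have K: "has_dir_deriv F (\<lambda>_. a) x v 0" for a :: 'f and x v :: 'e
    unfolding has_dir_deriv_def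
    by (rule limitin_const_punctured) (auto simp: F)
  have uniq: "dir_deriv F f x v = l" if "has_dir_deriv F f x v l" for f and x v :: 'e and l
    unfolding dir_deriv_def
  proof (rule the_equality)
    show "has_dir_deriv F f x v l" by (rule that)
    fix l' assume "has_dir_deriv F f x v l'"
    then show "l' = l"
      using that limitin_Hausdorff_unique[OF _ _ _ H] unfolding has_dir_deriv_def
      by (metis trivial_limit_at)
  qed
  have i1: "iter_deriv F L (Suc 0) v x = L (v 0)" for v x
    using uniq[OF D] by simp
  have i2: "iter_deriv F L (Suc (Suc j)) v x = 0" for j v x
  proof (induction j arbitrary: v x)
    case 0
    show ?case using uniq[OF K[of "L (v 0)" x "v 1"]] i1 by simp
  next
    case (Suc j)
    show ?case
      by (simp only: iter_deriv.simps(2)[of F L "Suc (Suc j)" v x] Suc.IH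
            uniq[OF K[of 0 x "v (Suc (Suc j))"]])
  qed
  have ex: "\<exists>l. has_dir_deriv F (iter_deriv F L j v) x (v j) l" for j v x
  proof -
    consider "j = 0" | "j = Suc 0" | i where "j = Suc (Suc i)" by (metis not0_implies_Suc)
    then show ?thesis
    proof cases
      case 1
      have "iter_deriv F L 0 v = L" by (rule ext) simp
      then show ?thesis using D 1 by metis
    next
      case 2
      have "iter_deriv F L j v = (\<lambda>_. L (v 0))" using i1 2 by (intro ext) metis
      then show ?thesis using K by metis
    next
      case 3
      have "iter_deriv F L j v = (\<lambda>_. 0)" using i2 3 by (intro ext) metis
      then show ?thesis using K by metis
    qed
  qed
  have cont: "continuous_map (prod_topology (subtopology E UNIV) (product_topology (\<lambda>_. E) {..<Suc j})) F
      (\<lambda>(x, v). iter_deriv F L (Suc j) v x)" for j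
  proof (cases j)
    case 0
    have "continuous_map (product_topology (\<lambda>_. E) {..<Suc j}) E (\<lambda>v. v 0)"
      by (rule continuous_map_product_projection) simp
    from continuous_map_compose[OF continuous_map_snd continuous_map_compose[OF this c]]
    show ?thesis unfolding 0 i1 by (simp add: comp_def case_prod_unfold)
  next
    case (Suc i)
    show ?thesis unfolding Suc i2 by (simp add: case_prod_unfold F)
  qed
  show ?thesis
    unfolding Ck_on_def using c ex cont by (simp del: iter_deriv.simps)
qed

lemma inv_into_UNIV_id: "inv_into UNIV (\<lambda>x. x) = (\<lambda>x. x)"
  by (rule ext, rule inv_into_f_eq) auto

lemma lc_space_mfd_simps [simp]:
  "mtop (lc_space_mfd E) = E" "model (lc_space_mfd E) = E"
  "atlas (lc_space_mfd E) = {(topspace E, \<lambda>x. x)}"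
  by (simp_all add: lc_space_mfd_def)

lemma Ck_manifold_seq_mfd: "Ck_manifold k seq_mfd"
proof -
  have "Hausdorff_space real_sequences" using lc_space_real_sequences by (simp add: lc_space_def)
  moreover from this have "Ck_on k real_sequences real_sequences UNIV (\<lambda>x. x)"
    by (intro Ck_on_linear) (auto intro: linearI)
  moreover have "homeomorphic_map real_sequences real_sequences (\<lambda>x. x)"
    using homeomorphic_map_id[of real_sequences real_sequences] unfolding id_def by blast
  moreover have "openin real_sequences UNIV"
    using openin_topspace[of real_sequences] by simp
  ultimately show ?thesis
    using lc_space_real_sequences
    by (simp add: Ck_manifold_def seq_mfd_def inv_into_UNIV_id comp_def)
qed

lemma seq_group_simps [simp]:
  "carrier seq_group = UNIV" "\<one>\<^bsub>seq_group\<^esub> = 0" "x \<otimes>\<^bsub>seq_group\<^esub> y = x + y"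
  by (simp_all add: seq_group_def)

lemma group_seq_group: "group seq_group"
proof (rule groupI)
  fix x :: "nat \<Rightarrow> real"
  have "- x \<otimes>\<^bsub>seq_group\<^esub> x = \<one>\<^bsub>seq_group\<^esub>" by simp
  then show "\<exists>y \<in> carrier seq_group. y \<otimes>\<^bsub>seq_group\<^esub> x = \<one>\<^bsub>seq_group\<^esub>"
    by (metis UNIV_I seq_group_simps(1))
qed (simp_all add: add.assoc)

lemma inv_seq_group: "inv\<^bsub>seq_group\<^esub> x = - x"
  by (rule group.inv_equality[OF group_seq_group]) simp_all

lemma Lie_group_seq_group: "Lie_group seq_group seq_mfd"
  unfolding Lie_group_def
proof (intro conjI)
  have lc: "lc_space real_sequences" by (rule lc_space_real_sequences)
  then have H: "Hausdorff_space real_sequences" by (simp add: lc_space_def)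
  have A: "continuous_map (prod_topology real_sequences real_sequences) real_sequences (\<lambda>(x, y). x + y)"
    using lc by (simp add: lc_space_def)
  have "Ck_on \<infinity> (prod_topology real_sequences real_sequences) real_sequences UNIV (\<lambda>(x, y). x + y)"
    by (rule Ck_on_linear[OF H _ _ _ A]) (auto intro!: linearI simp: algebra_simps)
  moreover have "map_prod (\<lambda>x. x) (\<lambda>x. x) = (\<lambda>x::(nat \<Rightarrow> real) \<times> (nat \<Rightarrow> real). x)"
    by (auto simp: fun_eq_iff)
  ultimately show "Ck_map \<infinity> (prod_mfd seq_mfd seq_mfd) seq_mfd (\<lambda>(x, y). x \<otimes>\<^bsub>seq_group\<^esub> y)"
    using A by (simp add: Ck_map_def prod_mfd_def seq_mfd_def inv_into_UNIV_id comp_def)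
  have "continuous_map real_sequences real_sequences ((\<lambda>(a, x). a *\<^sub>R x) \<circ> (\<lambda>x. (-1, x)))"
    by (rule continuous_map_compose[of _ "prod_topology euclideanreal real_sequences"])
       (use lc in \<open>auto simp: lc_space_def continuous_map_paired\<close>)
  then have B: "continuous_map real_sequences real_sequences (\<lambda>x. - x)" by (simp add: comp_def)
  have "Ck_on \<infinity> real_sequences real_sequences UNIV (\<lambda>x. - x)"
    by (rule Ck_on_linear[OF H _ _ _ B]) (auto intro!: linearI)
  then show "Ck_map \<infinity> seq_mfd seq_mfd (\<lambda>x. inv\<^bsub>seq_group\<^esub> x)"
    using B by (simp add: Ck_map_def seq_mfd_def inv_seq_group inv_into_UNIV_id comp_def)
qed (auto simp: group_seq_group Ck_manifold_seq_mfd, auto simp: seq_mfd_def)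

lemma subgroup_bounded_sequences: "subgroup bounded_sequences seq_group"
proof (rule group.subgroupI[OF group_seq_group])
  have iff: "x \<in> bounded_sequences \<longleftrightarrow> (\<exists>B. \<forall>i. \<bar>x i\<bar> \<le> B)" for x
    unfolding bounded_sequences_def bounded_iff by simp
  show "bounded_sequences \<subseteq> carrier seq_group" by simp
  have "0 \<in> bounded_sequences" unfolding iff by (rule exI[of _ 0]) simp
  then show "bounded_sequences \<noteq> {}" by blast
  show "inv\<^bsub>seq_group\<^esub> x \<in> bounded_sequences" if "x \<in> bounded_sequences" for x
    using that unfolding iff inv_seq_group by simp
  show "x \<otimes>\<^bsub>seq_group\<^esub> y \<in> bounded_sequences"
    if xy: "x \<in> bounded_sequences" "y \<in> bounded_sequences" for x y
  proof -
    obtain B C where "\<And>i. \<bar>x i\<bar> \<le> B" "\<And>i. \<bar>y i\<bar> \<le> C" using xy unfolding iff by blast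
    then have "\<bar>(x + y) i\<bar> \<le> B + C" for i
      using abs_triangle_ineq[of "x i" "y i"] add_mono[of "\<bar>x i\<bar>" B "\<bar>y i\<bar>" C] by fastforce
    then show ?thesis unfolding iff seq_group_simps by blast
  qed
qed

end

theory Submission
  imports Defs
begin

text \<open>
  The maps \<open>q\<^sub>R y = (R sin y\<^sub>n)\<^sub>n\<close> are smooth from \<open>\<real>\<^sup>\<nat>\<close> to itself with values in \<open>\<ell>\<^sup>\<infinity>\<close>, hence
  \<open>C\<^sup>k\<close> into an initial structure on \<open>\<ell>\<^sup>\<infinity>\<close>.  Images of compact sets under the \<open>q\<^sub>R\<close> show that the domain
  \<open>V\<close> of a chart \<open>\<phi>\<close> around \<open>0\<close> is a countable union of compact sets \<open>K\<close>.  The derivative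
  \<open>B = d(\<phi> \<circ> q\<^sub>1)(0, \<cdot>)\<close> is a continuous map from \<open>\<real>\<^sup>\<nat>\<close> to the modelling space, and by the chain rule it
  is right inverse to \<open>A = d(\<phi>\<^sup>-\<^sup>1)(\<phi> 0, \<cdot>)\<close>.  The closed sets \<open>{y. \<phi> 0 + B y \<in> \<phi>(K)}\<close> cover a nonempty open
  subset of \<open>\<real>\<^sup>\<nat>\<close>, so one of them has interior points by Baire's theorem; but \<open>A\<close> is continuous, so
  each coordinate is bounded on each of these sets, which is impossible.
\<close>

section \<open>Directional derivatives and a criterion for C^k maps\<close>

lemma limitin_at_cong:
  assumes "\<And>t. t \<noteq> 0 \<Longrightarrow> f t = g t"
  shows "limitin F f l (at (0::real)) \<longleftrightarrow> limitin F g l (at 0)"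
proof -
  have "eventually (\<lambda>t. f t = g t) (at (0::real))" "eventually (\<lambda>t. g t = f t) (at (0::real))"
    using assms by (auto simp: eventually_at intro: exI[of _ 1])
  then show ?thesis
    using limitin_transform_eventually[of f g] limitin_transform_eventually[of g f] by blast
qed

lemma dir_deriv_eqI:
  assumes "Hausdorff_space F" "has_dir_deriv F f x v l"
  shows "dir_deriv F f x v = l"
  unfolding dir_deriv_def
  using assms limitin_Hausdorff_unique[OF _ _ _ assms(1)]
  unfolding has_dir_deriv_def by (metis (no_types, lifting) the_equality trivial_limit_at)

lemma has_dir_deriv_dir_deriv:
  assumes "Hausdorff_space F" "\<exists>l. has_dir_deriv F f x v l"
  shows "has_dir_deriv F f x v (dir_deriv F f x v)"
  using assms dir_deriv_eqI by metis

lemma has_dir_deriv_affine: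
  assumes "l \<in> topspace F" "\<And>t. f (x + t *\<^sub>R v) = f x + t *\<^sub>R l"
  shows "has_dir_deriv F f x v l"
  unfolding has_dir_deriv_def by (rule limitin_const_punctured) (simp_all add: assms)

text \<open>The difference quotients involve only points \<open>x + t *\<^sub>R v\<close>, and this
  line stays in the subspace \<open>T\<close>.\<close>

lemma has_dir_deriv_cong_subspace:
  assumes "subspace T" "x \<in> T" "v \<in> T" "\<And>y. y \<in> T \<Longrightarrow> f y = g y"
  shows "has_dir_deriv F f x v l \<longleftrightarrow> has_dir_deriv F g x v l"
  unfolding has_dir_deriv_def
  by (rule limitin_at_cong) (use assms in \<open>auto simp: subspace_add subspace_scale\<close>)

text \<open>\<open>iter_deriv\<close> is built from definite descriptions. A guessed closed form
  \<open>D\<close> is certified here by induction: each step differentiates a function that agrees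
  with \<open>D j v\<close> on all of \<open>T\<close>, which is enough to transfer the
  derivative.\<close>

lemma iter_deriv_eqI:
  assumes H: "Hausdorff_space F" and T: "subspace T"
    and D0: "\<And>x v. x \<in> T \<Longrightarrow> f x = D 0 v x"
    and D: "\<And>j v x. x \<in> T \<Longrightarrow> (\<And>i. i \<le> j \<Longrightarrow> v i \<in> T) \<Longrightarrow> has_dir_deriv F (D j v) x (v j) (D (Suc j) v x)"
    and "x \<in> T" "\<And>i. i < j \<Longrightarrow> v i \<in> T"
  shows "iter_deriv F f j v x = D j v x"
  using assms(5,6)
proof (induction j arbitrary: x)
  case 0
  then show ?case using D0 by simp
next
  case (Suc j)
  have "has_dir_deriv F (iter_deriv F f j v) x (v j) l \<longleftrightarrow> has_dir_deriv F (D j v) x (v j) l" for l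
    by (rule has_dir_deriv_cong_subspace[OF T Suc.prems(1)]) (use Suc in auto)
  then have "has_dir_deriv F (iter_deriv F f j v) x (v j) (D (Suc j) v x)"
    using D Suc.prems by (simp add: less_Suc_eq_le)
  then show ?case using dir_deriv_eqI[OF H] by simp
qed

text \<open>A formula \<open>D\<close> covering all orders of differentiation settles every
  \<open>k\<close> at once.\<close>

lemma Ck_on_topspaceI:
  assumes H: "Hausdorff_space F" and T: "subspace (topspace E)"
    and c: "continuous_map E F f"
    and D0: "\<And>x v. x \<in> topspace E \<Longrightarrow> f x = D 0 v x"
    and D: "\<And>j v x. x \<in> topspace E \<Longrightarrow> (\<And>i. i \<le> j \<Longrightarrow> v i \<in> topspace E) \<Longrightarrow>
              has_dir_deriv F (D j v) x (v j) (D (Suc j) v x)"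
    and cD: "\<And>j. continuous_map (prod_topology E (product_topology (\<lambda>_. E) {..<Suc j})) F
              (\<lambda>(x, v). D (Suc j) v x)"
  shows "Ck_on k E F (topspace E) f"
  unfolding Ck_on_def subtopology_topspace
proof (intro conjI allI impI ballI)
  show "continuous_map E F f" by (rule c)
next
  note eq = iter_deriv_eqI[OF H T, of f D, OF D0 D]
  fix j x v assume x: "x \<in> topspace E" and v: "v \<in> {..<Suc j} \<rightarrow>\<^sub>E topspace E"
  have v: "v i \<in> topspace E" if "i < Suc j" for i using v that by (auto simp: PiE_iff)
  have "has_dir_deriv F (iter_deriv F f j v) x (v j) l \<longleftrightarrow> has_dir_deriv F (D j v) x (v j) l" for l
    by (rule has_dir_deriv_cong_subspace[OF T x v[OF lessI]]) (rule eq, simp_all add: v)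
  moreover have "has_dir_deriv F (D j v) x (v j) (D (Suc j) v x)"
    by (rule D[OF x]) (simp add: v)
  ultimately show "\<exists>l. has_dir_deriv F (iter_deriv F f j v) x (v j) l"
    by blast
next
  note eq = iter_deriv_eqI[OF H T, of f D, OF D0 D]
  fix j
  show "continuous_map (prod_topology E (product_topology (\<lambda>_. E) {..<Suc j})) F
          (\<lambda>(x, v). iter_deriv F f (Suc j) v x)"
    by (rule continuous_map_eq[OF cD[of j]]) (auto simp: PiE_iff simp del: iter_deriv.simps intro!: eq[symmetric])
qed

text \<open>The derivatives of order two and higher vanish. The space may be a proper subspace of
  its type, and \<open>f\<close> is prescribed only there because
  \<open>inv_into (topspace E) (\<lambda>x. x)\<close> is unspecified elsewhere.\<close>

lemma Ck_on_ident:
  assumes E: "lc_space E" and f: "\<And>x. x \<in> topspace E \<Longrightarrow> f x = x"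
  shows "Ck_on k E E (topspace E) f"
proof -
  define D :: "nat \<Rightarrow> (nat \<Rightarrow> 'a) \<Rightarrow> 'a \<Rightarrow> 'a"
    where "D j v x = (if j = 0 then x else if j = 1 then v 0 else 0)" for j v x
  have T: "subspace (topspace E)" and H: "Hausdorff_space E" using E by (auto simp: lc_space_def)
  have 0: "0 \<in> topspace E" using T subspace_0 by blast
  show ?thesis
  proof (rule Ck_on_topspaceI[OF H T, of f D])
    show "continuous_map E E f" by (rule continuous_map_eq[OF continuous_map_id[unfolded id_def]]) (simp add: f)
    show "f x = D 0 v x" if "x \<in> topspace E" for x v using f that by (simp add: D_def)
    show "has_dir_deriv E (D j v) x (v j) (D (Suc j) v x)"
      if "x \<in> topspace E" "\<And>i. i \<le> j \<Longrightarrow> v i \<in> topspace E" for j v x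
      by (rule has_dir_deriv_affine) (use that 0 in \<open>auto simp: D_def\<close>)
    show "continuous_map (prod_topology E (product_topology (\<lambda>_. E) {..<Suc j})) E (\<lambda>(x, v). D (Suc j) v x)" for j
    proof (cases "j = 0")
      case True
      have "continuous_map (product_topology (\<lambda>_. E) {..<Suc j}) E (\<lambda>v. v 0)"
        by (rule continuous_map_product_projection) simp
      from continuous_map_compose[OF continuous_map_snd this]
      show ?thesis by (simp add: D_def True comp_def case_prod_unfold)
    next
      case False
      then show ?thesis by (simp add: D_def 0 case_prod_unfold)
    qed
  qed
qed

section \<open>Locally convex spaces as manifolds; products and the zero space\<close>

lemma Ck_manifold_lc_space_mfd:
  assumes "lc_space E"
  shows "Ck_manifold k (lc_space_mfd E)"
proof -
  have "homeomorphic_map E E (\<lambda>x. x)"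
    using homeomorphic_map_id[of E E, unfolded id_def] by simp
  moreover have "Ck_on k E E (topspace E) ((\<lambda>x. x) \<circ> inv_into (topspace E) (\<lambda>x. x))"
    by (rule Ck_on_ident[OF assms]) (simp add: inv_into_f_eq)
  moreover have "Hausdorff_space E" using assms by (simp add: lc_space_def)
  ultimately show ?thesis using assms by (simp add: Ck_manifold_def)
qed

lemma lc_space_prod_topology:
  assumes E: "lc_space E" and F: "lc_space F"
  shows "lc_space (prod_topology E F)"
  unfolding lc_space_def
proof (intro conjI allI impI)
  let ?P = "prod_topology E F"
  have aE: "continuous_map (prod_topology E E) E (\<lambda>(x, y). x + y)"
    and aF: "continuous_map (prod_topology F F) F (\<lambda>(x, y). x + y)"
    and mE: "continuous_map (prod_topology euclideanreal E) E (\<lambda>(a, x). a *\<^sub>R x)"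
    and mF: "continuous_map (prod_topology euclideanreal F) F (\<lambda>(a, x). a *\<^sub>R x)"
    using E F by (auto simp: lc_space_def)
  have fs: "continuous_map (prod_topology X ?P) E (\<lambda>z. fst (snd z))"
     "continuous_map (prod_topology X ?P) F (\<lambda>z. snd (snd z))" for X :: "'c topology"
    using continuous_map_compose[OF continuous_map_snd continuous_map_fst]
      continuous_map_compose[OF continuous_map_snd continuous_map_snd] by (auto simp: comp_def)
  have ff: "continuous_map (prod_topology ?P X) E (\<lambda>z. fst (fst z))"
     "continuous_map (prod_topology ?P X) F (\<lambda>z. snd (fst z))" for X :: "'c topology"
    using continuous_map_compose[OF continuous_map_fst continuous_map_fst]
      continuous_map_compose[OF continuous_map_fst continuous_map_snd] by (auto simp: comp_def)
  show "subspace (topspace ?P)"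
    using E F by (simp add: lc_space_def subspace_Times)
  have "continuous_map (prod_topology ?P ?P) E (\<lambda>z. fst (fst z) + fst (snd z))"
    using continuous_map_compose[OF continuous_map_pairedI[OF ff(1) fs(1)] aE] by (simp add: comp_def)
  moreover have "continuous_map (prod_topology ?P ?P) F (\<lambda>z. snd (fst z) + snd (snd z))"
    using continuous_map_compose[OF continuous_map_pairedI[OF ff(2) fs(2)] aF] by (simp add: comp_def)
  ultimately show "continuous_map (prod_topology ?P ?P) ?P (\<lambda>(x, y). x + y)"
    by (simp add: case_prod_unfold plus_prod_def continuous_map_pairedI)
  have "continuous_map (prod_topology euclideanreal ?P) E (\<lambda>z. fst z *\<^sub>R fst (snd z))"
    using continuous_map_compose[OF continuous_map_pairedI[OF continuous_map_fst fs(1)] mE] by (simp add: comp_def)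
  moreover have "continuous_map (prod_topology euclideanreal ?P) F (\<lambda>z. fst z *\<^sub>R snd (snd z))"
    using continuous_map_compose[OF continuous_map_pairedI[OF continuous_map_fst fs(2)] mF] by (simp add: comp_def)
  ultimately show "continuous_map (prod_topology euclideanreal ?P) ?P (\<lambda>(a, x). a *\<^sub>R x)"
    by (simp add: case_prod_unfold scaleR_prod_def continuous_map_pairedI)
  show "Hausdorff_space ?P"
    using E F by (simp add: lc_space_def Hausdorff_space_prod_topology)
next
  fix U assume U: "openin (prod_topology E F) U \<and> 0 \<in> U"
  then obtain A B where AB: "openin E A" "openin F B" "0 \<in> A" "0 \<in> B" "A \<times> B \<subseteq> U"
    unfolding openin_prod_topology_alt zero_prod_def by meson
  then obtain A' B' where "openin E A'" "0 \<in> A'" "convex A'" "A' \<subseteq> A"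
      "openin F B'" "0 \<in> B'" "convex B'" "B' \<subseteq> B"
    using E F unfolding lc_space_def by meson
  then show "\<exists>V. openin (prod_topology E F) V \<and> 0 \<in> V \<and> convex V \<and> V \<subseteq> U"
    using AB(5) by (intro exI[of _ "A' \<times> B'"]) (auto simp: convex_Times openin_prod_Times_iff zero_prod_def)
qed

lemma lc_space_zero: "lc_space (discrete_topology {0::'a::real_vector})"
  unfolding lc_space_def
proof (intro conjI allI impI)
  let ?E = "discrete_topology {0::'a}"
  show "subspace (topspace ?E)" by (simp add: subspace_single_0)
  show "Hausdorff_space ?E" by (rule Hausdorff_space_discrete_topology)
  have 1: "continuous_map (prod_topology ?E ?E) ?E (\<lambda>_. 0)" by simp
  show "continuous_map (prod_topology ?E ?E) ?E (\<lambda>(x, y). x + y)"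
    by (rule continuous_map_eq[OF 1]) fastforce
  have 2: "continuous_map (prod_topology euclideanreal ?E) ?E (\<lambda>_. 0)" by simp
  show "continuous_map (prod_topology euclideanreal ?E) ?E (\<lambda>(a, x). a *\<^sub>R x)"
    by (rule continuous_map_eq[OF 2]) fastforce
next
  fix U :: "'a set" assume "openin (discrete_topology {0}) U \<and> 0 \<in> U"
  then show "\<exists>V. openin (discrete_topology {0}) V \<and> 0 \<in> V \<and> convex V \<and> V \<subseteq> U"
    by (intro exI[of _ "{0}"]) auto
qed

section \<open>Calculus of maps into the sequence space\<close>

lemma limitin_real_sequences:
  "limitin real_sequences f l F \<longleftrightarrow> (\<forall>i. ((\<lambda>c. f c i) \<longlongrightarrow> l i) F)"
  by (simp add: real_sequences_def limitin_componentwise)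

lemma has_dir_deriv_real_sequences:
  "has_dir_deriv real_sequences f x v l \<longleftrightarrow> (\<forall>i. has_dir_deriv euclideanreal (\<lambda>y. f y i) x v (l i))"
  by (simp add: has_dir_deriv_def limitin_real_sequences scaleR_fun_def)

lemma has_dir_deriv_iff_DERIV:
  "has_dir_deriv euclideanreal f x v l \<longleftrightarrow> DERIV (\<lambda>t. f (x + t *\<^sub>R v)) 0 :> l"
  by (simp add: has_dir_deriv_def DERIV_def divide_inverse_commute)

text \<open>Coordinate \<open>n\<close> of \<open>f\<close> involves only the continuous linear
  functional \<open>\<lambda>x. g x n\<close>. Limits and continuity in the product topology are
  checked coordinatewise, so smoothness reduces to calculus with one scalar sine.\<close>

lemma Ck_on_sin:
  fixes g :: "'e::real_vector \<Rightarrow> (nat \<Rightarrow> real)"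
  assumes T: "subspace (topspace E)" and L: "linear g" and c: "continuous_map E real_sequences g"
    and f: "\<And>x. x \<in> topspace E \<Longrightarrow> f x = (\<lambda>n. R * sin (g x n))"
  shows "Ck_on k E real_sequences (topspace E) f"
proof -
  \<comment> \<open>adding \<open>\<pi>/2\<close> to the argument differentiates the sine, which gives all derivatives in one formula\<close>
  define D :: "nat \<Rightarrow> (nat \<Rightarrow> 'e) \<Rightarrow> 'e \<Rightarrow> nat \<Rightarrow> real"
    where "D j v x = (\<lambda>n. R * (\<Prod>i<j. g (v i) n) * sin (g x n + real j * (pi / 2)))" for j v x
  have H: "Hausdorff_space real_sequences" using lc_space_real_sequences by (simp add: lc_space_def)
  have cg: "continuous_map E euclideanreal (\<lambda>x. g x n)" for n
    using c by (simp add: into_real_sequences)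
  have sin: "continuous_map X euclideanreal (\<lambda>x. sin (h x))" if "continuous_map X euclideanreal h"
    for X :: "'c topology" and h
    using continuous_map_compose[OF that, of euclideanreal sin] by (simp add: comp_def continuous_on_sin)
  show ?thesis
  proof (rule Ck_on_topspaceI[OF H T, of f D])
    show "continuous_map E real_sequences f"
      by (rule continuous_map_eq[of _ _ "\<lambda>x n. R * sin (g x n)"])
         (auto simp: f into_real_sequences intro!: continuous_map_real_mult sin cg)
    show "f x = D 0 v x" if "x \<in> topspace E" for x v
      using that by (simp add: f D_def)
    show "has_dir_deriv real_sequences (D j v) x (v j) (D (Suc j) v x)" for j v x
      unfolding has_dir_deriv_real_sequences has_dir_deriv_iff_DERIV
    proof
      fix i
      have *: "D (Suc j) v x i = R * (\<Prod>i'<j. g (v i') i) * (cos (g x i + real j * (pi / 2)) * g (v j) i)"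
      proof -
        have "sin (a + (b + pi / 2)) = cos (a + b)" for a b :: real
          by (simp add: add.assoc[symmetric] sin_add[of "a + b" "pi / 2"])
        moreover have "real (Suc j) * (pi / 2) = real j * (pi / 2) + pi / 2"
          by (simp add: distrib_right)
        ultimately have "sin (g x i + real (Suc j) * (pi / 2)) = cos (g x i + real j * (pi / 2))"
          by metis
        then show ?thesis unfolding D_def by (simp only: prod.lessThan_Suc ac_simps)
      qed
      show "DERIV (\<lambda>t. D j v (x + t *\<^sub>R v j) i) 0 :> D (Suc j) v x i"
        unfolding * unfolding D_def linear_add[OF L] linear_cmul[OF L] plus_fun_def scaleR_fun_def
        by (auto intro!: derivative_eq_intros)
    qed
    show "continuous_map (prod_topology E (product_topology (\<lambda>_. E) {..<Suc j})) real_sequences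
            (\<lambda>(x, v). D (Suc j) v x)" for j
    proof -
      let ?Z = "prod_topology E (product_topology (\<lambda>_. E) {..<Suc j})"
      have a: "continuous_map ?Z euclideanreal (\<lambda>z. g (fst z) n)" for n
        using continuous_map_compose[OF continuous_map_fst cg] by (simp add: comp_def)
      have b: "continuous_map ?Z euclideanreal (\<lambda>z. g (snd z i) n)" if "i < Suc j" for i n
      proof -
        have "continuous_map (product_topology (\<lambda>_. E) {..<Suc j}) E (\<lambda>v. v i)"
          by (rule continuous_map_product_projection) (use that in simp)
        from continuous_map_compose[OF continuous_map_snd continuous_map_compose[OF this cg]]
        show ?thesis by (simp add: comp_def)
      qed
      have P: "continuous_map ?Z euclideanreal (\<lambda>z. \<Prod>i<Suc j. g (snd z i) n)" for n
        by (rule continuous_map_prod) (simp_all only: finite_lessThan lessThan_iff b)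
      have S: "continuous_map ?Z euclideanreal (\<lambda>z. sin (g (fst z) n + c))" for n c
        by (rule sin, rule continuous_map_add[OF a]) simp
      have "continuous_map ?Z euclideanreal (\<lambda>_. R)" by simp
      then show ?thesis
        unfolding case_prod_unfold into_real_sequences D_def
        by (intro allI continuous_map_real_mult[OF continuous_map_real_mult S] P)
    qed
  qed
qed

section \<open>First-order derivatives and differentiation along paths\<close>

text \<open>
  The mean value theorem along \<open>s \<mapsto> h (x\<^sub>0 + s y\<^sub>t)\<close> turns the joint continuity of the
  directional derivative into differentiability along paths with a prescribed velocity.
\<close>

lemma dir_deriv_along_path:
  fixes E :: "'e::real_vector topology" and h :: "'e \<Rightarrow> real" and D :: "'e \<Rightarrow> 'e \<Rightarrow> real"
  assumes E: "lc_space E" and U: "openin E U" and x0: "x0 \<in> U"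
    and D: "\<And>x v. x \<in> U \<Longrightarrow> v \<in> topspace E \<Longrightarrow> has_dir_deriv euclideanreal h x v (D x v)"
    and c: "continuous_map (prod_topology (subtopology E U) E) euclideanreal (\<lambda>(x, v). D x v)"
    and y: "limitin E y y0 (at (0::real))"
  shows "((\<lambda>t. (h (x0 + t *\<^sub>R y t) - h x0) / t) \<longlongrightarrow> D x0 y0) (at 0)"
proof (rule tendstoI)
  fix e :: real assume e: "e > 0"
  have y0: "y0 \<in> topspace E" using y by (simp add: limitin_def)
  have UE: "U \<subseteq> topspace E" using U openin_subset by blast
  have a: "continuous_map (prod_topology E E) E (\<lambda>(x, y). x + y)"
    and m: "continuous_map (prod_topology euclideanreal E) E (\<lambda>(a, x). a *\<^sub>R x)"
    using E by (auto simp: lc_space_def)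
  let ?Z = "prod_topology (subtopology E U) E"
  have "openin ?Z {z \<in> topspace ?Z. (\<lambda>(x, v). D x v) z \<in> ball (D x0 y0) e}"
    by (rule openin_continuous_map_preimage[OF c]) simp
  moreover have "(x0, y0) \<in> {z \<in> topspace ?Z. (\<lambda>(x, v). D x v) z \<in> ball (D x0 y0) e}"
    using x0 y0 e UE by auto
  ultimately obtain U1 V1 where U1: "openin (subtopology E U) U1" "openin E V1" "x0 \<in> U1" "y0 \<in> V1"
      and UV: "U1 \<times> V1 \<subseteq> {z \<in> topspace ?Z. (\<lambda>(x, v). D x v) z \<in> ball (D x0 y0) e}"
    unfolding openin_prod_topology_alt by meson
  have oU1: "openin E U1" using U1(1) U openin_trans_full by blast
  have U1U: "U1 \<subseteq> U" using U1(1) openin_subset by fastforce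
  have "continuous_map (prod_topology euclideanreal E) E (\<lambda>z. x0 + fst z *\<^sub>R snd z)" (is ?c)
    using continuous_map_compose[OF continuous_map_pairedI[OF _ m] a, of "\<lambda>_. x0"] x0 UE
    by (auto simp: comp_def case_prod_unfold)
  \<comment> \<open>\<open>Q\<close> yields one bound \<open>d\<close> on the parameter for all
    directions in \<open>V2\<close>, so that whole segments starting at \<open>x0\<close> stay in
    \<open>U1\<close>.\<close>
  define Q where "Q = {z \<in> topspace (prod_topology euclideanreal E). x0 + fst z *\<^sub>R snd z \<in> U1}"
  have "openin (prod_topology euclideanreal E) Q"
    unfolding Q_def by (rule openin_continuous_map_preimage[OF \<open>?c\<close> oU1])
  moreover have "(0, y0) \<in> Q"
    using y0 U1(3) by (simp add: Q_def)
  ultimately obtain I V2 where V2: "openin euclideanreal I" "openin E V2" "0 \<in> I" "y0 \<in> V2" "I \<times> V2 \<subseteq> Q"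
    unfolding openin_prod_topology_alt by meson
  obtain d where d: "d > 0" "ball 0 d \<subseteq> I" using V2(1,3) openE by (metis open_openin)
  have "openin E (V1 \<inter> V2)" "y0 \<in> V1 \<inter> V2" using U1 V2 by auto
  then have "eventually (\<lambda>t. y t \<in> V1 \<inter> V2) (at 0)" using y unfolding limitin_def by blast
  moreover have "eventually (\<lambda>t. t \<in> ball 0 d - {0}) (at (0::real))"
    using d by (auto simp: eventually_at intro: exI[of _ d])
  ultimately show "\<forall>\<^sub>F t in at 0. dist ((h (x0 + t *\<^sub>R y t) - h x0) / t) (D x0 y0) < e"
  proof eventually_elim
    case (elim t)
    \<comment> \<open>With \<open>t\<close> fixed the velocity is frozen, so the mean value theorem
      is applied along a straight segment, not along the path itself.\<close>
    define w where "w = y t"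
    have w: "w \<in> V1" "w \<in> V2" "w \<in> topspace E" using elim U1 openin_subset by (auto simp: w_def)
    have t: "t \<noteq> 0" "\<bar>t\<bar> < d" using elim by auto
    have in1: "x0 + s *\<^sub>R w \<in> U1" if "\<bar>s\<bar> \<le> \<bar>t\<bar>" for s
    proof -
      have "s \<in> I" using d that t by (auto simp: subset_iff dist_real_def)
      then show ?thesis using V2(5) w by (auto simp: Q_def subset_iff)
    qed
    have der: "DERIV (\<lambda>s. h (x0 + s *\<^sub>R w)) s :> D (x0 + s *\<^sub>R w) w" if "\<bar>s\<bar> \<le> \<bar>t\<bar>" for s
    proof -
      have "has_dir_deriv euclideanreal h (x0 + s *\<^sub>R w) w (D (x0 + s *\<^sub>R w) w)"
        using D in1[OF that] U1U w by blast
      then show ?thesis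
        by (simp add: has_dir_deriv_def DERIV_def divide_inverse_commute scaleR_add_left add.assoc)
    qed
    have "\<exists>s. \<bar>s\<bar> \<le> \<bar>t\<bar> \<and> h (x0 + t *\<^sub>R w) - h x0 = t * D (x0 + s *\<^sub>R w) w"
    \<comment> \<open>The mean value theorem takes its endpoints \<open>0\<close> and
      \<open>t\<close> in increasing order.\<close>
    proof (cases "t > 0")
      case True
      have "\<exists>s>0. s < t \<and> h (x0 + t *\<^sub>R w) - h (x0 + 0 *\<^sub>R w) = (t - 0) * D (x0 + s *\<^sub>R w) w"
        by (rule MVT2[OF True]) (rule der, simp)
      then obtain s where "0 < s" "s < t" "h (x0 + t *\<^sub>R w) - h (x0 + 0 *\<^sub>R w) = (t - 0) * D (x0 + s *\<^sub>R w) w"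
        by blast
      then show ?thesis by (intro exI[of _ s]) simp
    next
      case False
      with t have "t < 0" by simp
      have "\<exists>s>t. s < 0 \<and> h (x0 + 0 *\<^sub>R w) - h (x0 + t *\<^sub>R w) = (0 - t) * D (x0 + s *\<^sub>R w) w"
        by (rule MVT2[OF \<open>t < 0\<close>]) (rule der, simp)
      then obtain s where "t < s" "s < 0" "h (x0 + 0 *\<^sub>R w) - h (x0 + t *\<^sub>R w) = (0 - t) * D (x0 + s *\<^sub>R w) w"
        by blast
      then show ?thesis by (intro exI[of _ s]) simp
    qed
    then obtain s where s: "\<bar>s\<bar> \<le> \<bar>t\<bar>" "h (x0 + t *\<^sub>R w) - h x0 = t * D (x0 + s *\<^sub>R w) w" by blast
    have "(x0 + s *\<^sub>R w, w) \<in> U1 \<times> V1" using in1[OF s(1)] w(1) by (rule SigmaI)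
    from subsetD[OF UV this] have "D (x0 + s *\<^sub>R w) w \<in> ball (D x0 y0) e" by simp
    then show ?case using s(2) t by (simp add: w_def dist_commute)
  qed
qed

text \<open>This is the case \<open>j = 0\<close> of \<open>Ck_on\<close>, with the tuple of a
  single direction replaced by the direction itself.\<close>

lemma Ck_on_imp_dir_deriv:
  assumes f: "Ck_on k E F U f" and "k \<noteq> 0" and H: "Hausdorff_space F"
  shows "\<And>x v. x \<in> U \<Longrightarrow> v \<in> topspace E \<Longrightarrow> has_dir_deriv F f x v (dir_deriv F f x v)"
    and "continuous_map (prod_topology (subtopology E U) E) F (\<lambda>(x, v). dir_deriv F f x v)"
proof -
  have "enat (Suc 0) \<le> k"
    using \<open>k \<noteq> 0\<close> by (metis ileI1 one_eSuc one_enat_def zero_less_iff_neq_zero One_nat_def)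
  with f have ex: "\<And>x v. x \<in> U \<Longrightarrow> v \<in> {..<Suc 0} \<rightarrow>\<^sub>E topspace E \<Longrightarrow>
        \<exists>l. has_dir_deriv F (iter_deriv F f 0 v) x (v 0) l"
    and c: "continuous_map (prod_topology (subtopology E U) (product_topology (\<lambda>_. E) {..<Suc 0})) F
          (\<lambda>(x, v). iter_deriv F f (Suc 0) v x)"
    unfolding Ck_on_def by blast+
  have 0: "iter_deriv F f 0 v = f" for v by (rule ext) simp
  show "has_dir_deriv F f x v (dir_deriv F f x v)" if "x \<in> U" "v \<in> topspace E" for x v
  proof (rule has_dir_deriv_dir_deriv[OF H])
    show "\<exists>l. has_dir_deriv F f x v l"
      using ex[of x "\<lambda>i\<in>{..<Suc 0}. v"] that by (simp add: 0)
  qed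
  let ?Z = "prod_topology (subtopology E U) E"
  have "continuous_map ?Z (product_topology (\<lambda>_. E) {..<Suc 0}) (\<lambda>z. \<lambda>i\<in>{..<Suc 0}. snd z)"
    by (auto simp: continuous_map_componentwise continuous_map_snd)
  from continuous_map_compose[OF continuous_map_pairedI[OF continuous_map_fst this] c]
  show "continuous_map ?Z F (\<lambda>(x, v). dir_deriv F f x v)"
    by (simp add: comp_def case_prod_unfold)
qed

section \<open>Baire category and sigma-compactness\<close>

text \<open>A nonempty basic open set of the product leaves some coordinate free, and that
  coordinate is unbounded on it. Hence each member of \<open>\<L>\<close> has empty interior, and
  Baire's theorem applies.\<close>

lemma Baire_real_sequences:
  assumes "countable \<L>" and cl: "\<And>L. L \<in> \<L> \<Longrightarrow> closedin real_sequences L"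
    and bdd: "\<And>L n. L \<in> \<L> \<Longrightarrow> bounded ((\<lambda>y. y n) ` L)"
  shows "real_sequences interior_of \<Union>\<L> = {}"
proof (rule Baire_category_alt)
  show "completely_metrizable_space real_sequences \<or> locally_compact_space real_sequences \<and> regular_space real_sequences"
    unfolding real_sequences_def
    by (auto simp: completely_metrizable_space_product_topology completely_metrizable_space_euclidean)
next
  fix L assume L: "L \<in> \<L>"
  have False if y: "y \<in> real_sequences interior_of L" for y
  proof -
    obtain B where B: "finite {i \<in> UNIV. B i \<noteq> topspace euclideanreal}" "y \<in> Pi\<^sub>E UNIV B"
      "Pi\<^sub>E UNIV B \<subseteq> real_sequences interior_of L"
      using openin_interior_of[of real_sequences L] y
      unfolding real_sequences_def openin_product_topology_alt by meson
    obtain n where n: "B n = UNIV"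
      using ex_new_if_finite[OF infinite_UNIV_nat B(1)] by auto
    have "c \<in> (\<lambda>y. y n) ` L" for c
    proof
      have "y(n := c) \<in> Pi\<^sub>E UNIV B" using B(2) n by (auto simp: PiE_iff)
      from subsetD[OF interior_of_subset subsetD[OF B(3) this]] show "y(n := c) \<in> L" .
    qed simp
    then have "(\<lambda>y. y n) ` L = UNIV" by blast
    then show False using bdd[OF L, of n] not_bounded_UNIV[where 'a = real] by simp
  qed
  then show "closedin real_sequences L \<and> real_sequences interior_of L = {}"
    using cl[OF L] by blast
qed (rule assms)

text \<open>
  The \<open>R\<close>-th map sends the compact cube \<open>[-\<pi>/2, \<pi>/2]\<^sup>\<nat>\<close> onto the set of all sequences bounded by \<open>R\<close>.
\<close>

lemma openin_bounded_sequences_sigma_compact: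
  assumes q: "\<And>R::nat. continuous_map real_sequences N (\<lambda>y n. real R * sin (y n))"
    and N: "topspace N = bounded_sequences" and V: "openin N V"
  shows "\<exists>\<K>. countable \<K> \<and> (\<forall>K \<in> \<K>. compactin N K) \<and> \<Union>\<K> = V"
proof -
  define q where "q R y = (\<lambda>n. real R * sin (y n))" for R :: nat and y :: "nat \<Rightarrow> real"
  have q: "continuous_map real_sequences N (q R)" for R
    using q[of R] unfolding q_def .
  define P where "P = Pi\<^sub>E UNIV (\<lambda>_::nat. {-(pi/2)..pi/2})"
  have P: "compactin real_sequences P"
    unfolding real_sequences_def P_def by (simp add: compactin_PiE)
  \<comment> \<open>Open sets of a metrizable space are countable unions of closed sets. Applied to
    the preimage of \<open>V\<close> under \<open>q R\<close>, this cuts the compact cube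
    \<open>P\<close> into compact pieces whose images lie in \<open>V\<close>.\<close>
  have "metrizable_space real_sequences"
    unfolding real_sequences_def
    by (simp add: metrizable_space_product_topology metrizable_space_euclidean)
  moreover have "openin real_sequences {y. q R y \<in> V}" for R
    using openin_continuous_map_preimage[OF q V] by simp
  ultimately have "fsigma_in real_sequences {y. q R y \<in> V}" for R
    using open_imp_fsigma_in by blast
  then have "\<forall>R. \<exists>\<C>. countable \<C> \<and> \<C> \<subseteq> Collect (closedin real_sequences) \<and> \<Union>\<C> = {y. q R y \<in> V}"
    by (simp add: fsigma_in_def union_of_def)
  then obtain \<C> where C: "\<And>R. countable (\<C> R)" "\<And>R. \<C> R \<subseteq> Collect (closedin real_sequences)"
      "\<And>R. \<Union>(\<C> R) = {y. q R y \<in> V}"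
    by metis
  define \<K> where "\<K> = (\<Union>R. (\<lambda>C. q R ` (P \<inter> C)) ` \<C> R)"
  have "countable \<K>" using C(1) by (simp add: \<K>_def)
  moreover have "compactin N K" if K: "K \<in> \<K>" for K
  proof -
    obtain R C where "K = q R ` (P \<inter> C)" "C \<in> \<C> R" using K unfolding \<K>_def by blast
    then show ?thesis using image_compactin[OF compact_Int_closedin[OF P] q] C(2)[of R] by auto
  qed
  moreover have "\<Union>\<K> \<subseteq> V" using C(3) unfolding \<K>_def by blast
  moreover have "V \<subseteq> \<Union>\<K>"
  proof
    fix x assume x: "x \<in> V"
    then have "x \<in> bounded_sequences" using V N openin_subset by blast
    then obtain b where b: "\<And>n. \<bar>x n\<bar> \<le> b"
      unfolding bounded_sequences_def bounded_iff by auto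
    \<comment> \<open>The maximum with \<open>1\<close> keeps \<open>R\<close> positive even if
      \<open>b = 0\<close>, so that dividing by \<open>R\<close> brings all entries of
      \<open>x\<close> into the domain of \<open>arcsin\<close>.\<close>
    obtain R :: nat where R: "real R \<ge> b" "R > 0"
      using real_arch_simple[of "max b 1"] by auto
    define y where "y = (\<lambda>n. arcsin (x n / real R))"
    have bd: "-1 \<le> x n / real R" "x n / real R \<le> 1" for n
      using b[of n] R by (auto simp: field_simps abs_le_iff)
    have "q R y = x" using bd R by (simp add: q_def y_def)
    moreover have "y \<in> P" using bd arcsin_bounded by (simp add: P_def PiE_iff y_def)
    ultimately have "y \<in> P \<inter> \<Union>(\<C> R)" "x = q R y" using x C(3) by auto
    then show "x \<in> \<Union>\<K>" unfolding \<K>_def by blast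
  qed
  ultimately show ?thesis by blast
qed

lemma lc_space_zero_times_real_sequences:
  "lc_space (prod_topology (discrete_topology {0::'u::real_vector}) real_sequences)"
  by (rule lc_space_prod_topology[OF lc_space_zero lc_space_real_sequences])

section \<open>The test maps and the contradiction\<close>

text \<open>
  The factor \<open>{0}\<close> places a copy of \<open>\<real>\<^sup>\<nat>\<close> in the universe of the test manifolds.
\<close>

lemma Ck_initial_structure_imp_Ck_on:
  fixes S :: "(nat \<Rightarrow> real, 'e::real_vector) mfd" and R :: real and k :: enat
  defines "T \<equiv> prod_topology (discrete_topology {0::'u::real_vector}) real_sequences"
    and "f \<equiv> \<lambda>(p::'u \<times> (nat \<Rightarrow> real)) n. R * sin (snd p n)"
  assumes S: "Ck_initial_structure TYPE('u \<times> (nat \<Rightarrow> real)) k seq_mfd S"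
    and topS: "topspace (mtop S) = bounded_sequences"
  shows "continuous_map T (mtop S) f"
    and "(V, \<phi>) \<in> atlas S \<Longrightarrow>
      Ck_on k T (model S) (topspace T \<inter> f -` V) (\<phi> \<circ> f \<circ> inv_into (topspace T) (\<lambda>x. x))"
proof -
  have lc: "lc_space T" unfolding T_def by (rule lc_space_zero_times_real_sequences)
  then have sub: "subspace (topspace T)" by (simp add: lc_space_def)
  have snd: "continuous_map T real_sequences snd" unfolding T_def by (rule continuous_map_snd)
  \<comment> \<open>The chart of \<open>lc_space_mfd T\<close> enters \<open>Ck_map\<close> through
    \<open>inv_into\<close>, so the C^k condition is needed for this composite, which agrees with
    \<open>f\<close> on \<open>topspace T\<close>.\<close>
  have "Ck_on k T real_sequences (topspace T) ((\<lambda>x. x) \<circ> ((\<lambda>x. x) \<circ> f) \<circ> inv_into (topspace T) (\<lambda>x. x))"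
    by (rule Ck_on_sin[OF sub linear_snd snd]) (simp add: f_def inv_into_f_eq)
  moreover have "Ck_on k T real_sequences (topspace T) f"
    by (rule Ck_on_sin[OF sub linear_snd snd]) (simp add: f_def)
  then have "continuous_map T real_sequences f" by (simp add: Ck_on_def)
  ultimately have M: "Ck_map k (lc_space_mfd T) seq_mfd ((\<lambda>x. x) \<circ> f)"
    by (simp add: Ck_map_def seq_mfd_def comp_def)
  have "f p \<in> bounded_sequences" for p
  proof -
    have "\<bar>f p n\<bar> \<le> \<bar>R\<bar>" for n
      using mult_left_le[of "\<bar>sin (snd p n)\<bar>" "\<bar>R\<bar>"] by (simp add: f_def abs_mult)
    then show ?thesis unfolding bounded_sequences_def bounded_iff by auto
  qed
  then have "Ck_map k (lc_space_mfd T) S f"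
    using S Ck_manifold_lc_space_mfd[OF lc] M unfolding Ck_initial_structure_def topS by simp
  then show "continuous_map T (mtop S) f"
    and "(V, \<phi>) \<in> atlas S \<Longrightarrow>
      Ck_on k T (model S) (topspace T \<inter> f -` V) (\<phi> \<circ> f \<circ> inv_into (topspace T) (\<lambda>x. x))"
    unfolding Ck_map_def by auto
qed

text \<open>First derivatives already give the contradiction, so one argument covers all
  \<open>k \<noteq> 0\<close>.\<close>

lemma bounded_sequences_not_initial:
  fixes S :: "(nat \<Rightarrow> real, 'e::real_vector) mfd"
  assumes S: "Ck_initial_structure TYPE('u::real_vector \<times> (nat \<Rightarrow> real)) k seq_mfd S"
    and topS: "topspace (mtop S) = bounded_sequences" and k: "k \<noteq> 0"
  shows False
proof -
  define T where "T = prod_topology (discrete_topology {0::'u}) real_sequences"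
  define f where "f R = (\<lambda>(p::'u \<times> (nat \<Rightarrow> real)) n. R * sin (snd p n))" for R :: real
  note f = Ck_initial_structure_imp_Ck_on[OF S topS, folded T_def f_def]
  define E where "E = model S"
  have S': "Ck_manifold k S" "Ck_map k S seq_mfd (\<lambda>x. x)"
    using S by (simp_all add: Ck_initial_structure_def)
  have E: "lc_space E" and HE: "Hausdorff_space E" and subE: "subspace (topspace E)"
    using S'(1) by (auto simp: Ck_manifold_def lc_space_def E_def)
  have topT: "topspace T = {0} \<times> UNIV" by (simp add: T_def)

  \<comment> \<open>Through \<open>y \<mapsto> (0, y)\<close> the continuity of the test maps
    becomes continuity on the sequence space itself.\<close>
  have emb: "continuous_map real_sequences T (\<lambda>y. (0, y))"
    unfolding T_def continuous_map_paired by simp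
  have q: "continuous_map real_sequences (mtop S) (\<lambda>y n. R * sin (y n))" for R
    using continuous_map_compose[OF emb f(1)[of R]] by (simp add: f_def comp_def)

  have "0 \<in> topspace (mtop S)"
    unfolding topS using subgroup.one_closed[OF subgroup_bounded_sequences] by simp
  then obtain V \<phi> where chart: "(V, \<phi>) \<in> atlas S" and V0: "0 \<in> V"
    using S'(1) unfolding Ck_manifold_def by blast
  have V: "openin (mtop S) V" and U: "openin E (\<phi> ` V)"
    and hom: "homeomorphic_map (subtopology (mtop S) V) (subtopology E (\<phi> ` V)) \<phi>"
    using S'(1) chart unfolding Ck_manifold_def E_def by auto
  have VN: "V \<subseteq> topspace (mtop S)" using V by (rule openin_subset)
  have inj: "inj_on \<phi> V"
    using homeomorphic_imp_injective_map[OF hom] VN by (simp add: Int_absorb1)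
  have UE: "\<phi> ` V \<subseteq> topspace E" using U by (rule openin_subset)

  obtain \<K> where "countable \<K>" and K: "\<And>K. K \<in> \<K> \<Longrightarrow> compactin (mtop S) K" and UnK: "\<Union>\<K> = V"
    using openin_bounded_sequences_sigma_compact[OF q topS V] by blast
  have \<phi>K: "compactin E (\<phi> ` K)" if "K \<in> \<K>" for K
  proof -
    have "compactin (subtopology (mtop S) V) K" using K[OF that] that UnK by (auto simp: compactin_subtopology)
    from image_compactin[OF this homeomorphic_imp_continuous_map[OF hom]]
    show ?thesis by (simp add: compactin_subtopology)
  qed

  \<comment> \<open>\<open>h\<close> is the inclusion read in the chart \<open>\<phi>\<close>, hence
    C^k into the sequence space; \<open>A\<close> collects the coordinates of its
    derivative.\<close>
  define h where "h = inv_into V \<phi>"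
  have h: "h (\<phi> x) = x" if "x \<in> V" for x using inj that by (simp add: h_def)
  define A where "A x v n = dir_deriv real_sequences h x v n" for x v n
  have "Ck_on k E real_sequences (\<phi> ` V) h"
    using S'(2) chart unfolding Ck_map_def by (force simp: seq_mfd_def E_def h_def comp_def)
  moreover have "Hausdorff_space real_sequences" using lc_space_real_sequences by (simp add: lc_space_def)
  ultimately have h': "\<And>x v. x \<in> \<phi> ` V \<Longrightarrow> v \<in> topspace E \<Longrightarrow>
        has_dir_deriv real_sequences h x v (dir_deriv real_sequences h x v)"
      "continuous_map (prod_topology (subtopology E (\<phi> ` V)) E) real_sequences (\<lambda>(x, v). dir_deriv real_sequences h x v)"
    using Ck_on_imp_dir_deriv k by blast+
  have A: "has_dir_deriv euclideanreal (\<lambda>z. h z n) x v (A x v n)" if "x \<in> \<phi> ` V" "v \<in> topspace E" for x v n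
    using h'(1)[OF that] by (simp add: has_dir_deriv_real_sequences A_def)
  have cA: "continuous_map (prod_topology (subtopology E (\<phi> ` V)) E) euclideanreal (\<lambda>(x, v). A x v n)" for n
    using h'(2) by (simp add: into_real_sequences A_def case_prod_unfold)

  \<comment> \<open>\<open>F\<close> is the test map with \<open>R = 1\<close> read in the chart.
    Its domain \<open>O'\<close> contains the origin because sine vanishes at \<open>0\<close> and
    \<open>0 \<in> V\<close>.\<close>
  define F where "F = \<phi> \<circ> f 1 \<circ> inv_into (topspace T) (\<lambda>x. x)"
  have F: "F (0, y) = \<phi> (\<lambda>n. sin (y n))" for y
    by (simp add: F_def f_def inv_into_f_eq topT)
  define O' where "O' = topspace T \<inter> f 1 -` V"
  define B where "B y = dir_deriv E F (0, 0) (0, y)" for y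
  have O0: "(0, 0) \<in> O'" using V0 by (simp add: O'_def topT f_def zero_fun_def)
  have "Ck_on k T E O' F" using f(2)[OF chart, of 1] by (simp add: O'_def F_def E_def)
  note F' = Ck_on_imp_dir_deriv[OF this k HE]
  have B: "has_dir_deriv E F (0, 0) (0, y) (B y)" for y
    unfolding B_def by (rule F'(1)[OF O0]) (simp add: topT)
  have "continuous_map real_sequences (prod_topology (subtopology T O') T) (\<lambda>y. ((0, 0), (0, y)))"
    unfolding continuous_map_paired using emb O0 by (simp add: O'_def)
  from continuous_map_compose[OF this F'(2)]
  have cB: "continuous_map real_sequences E B" by (simp add: comp_def B_def[abs_def])
  have BE: "B y \<in> topspace E" for y using continuous_map_image_subset_topspace[OF cB] by auto
  have "has_dir_deriv E F (0, 0) (0, 0) 0"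
    by (rule has_dir_deriv_affine) (simp_all add: subspace_0[OF subE] flip: zero_prod_def)
  then have B0: "B 0 = 0" unfolding B_def by (rule dir_deriv_eqI[OF HE])

  have AB: "A (\<phi> 0) (B y) n = y n" for y n
  proof -
    \<comment> \<open>\<open>w t\<close> is the difference quotient of \<open>F\<close> at the
      origin and tends to \<open>B y\<close>. For \<open>t \<noteq> 0\<close>,
      \<open>\<phi> 0 + t *\<^sub>R w t\<close> is the chart image of the sequence
      \<open>sin (t * y n)\<close>, so the derivative of coordinate \<open>n\<close> of
      \<open>h\<close> along this path can be computed in two ways.\<close>
    define w where "w t = (1 / t) *\<^sub>R (\<phi> (\<lambda>n. sin (t * y n)) - \<phi> 0)" for t :: real
    have "limitin E w (B y) (at 0)"
      using B[of y] by (simp add: has_dir_deriv_def F w_def[abs_def] scaleR_fun_def flip: zero_fun_def)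
    from dir_deriv_along_path[OF E U imageI[OF V0], of "\<lambda>z. h z n" "\<lambda>x v. A x v n", OF A cA this]
    have 1: "((\<lambda>t. (h (\<phi> 0 + t *\<^sub>R w t) n - h (\<phi> 0) n) / t) \<longlongrightarrow> A (\<phi> 0) (B y) n) (at 0)" .
    \<comment> \<open>For small \<open>t\<close> the sequence \<open>sin (t * y n)\<close> must lie
      in \<open>V\<close>, since only there does \<open>h\<close> invert
      \<open>\<phi>\<close>.\<close>
    have "continuous_map euclideanreal real_sequences (\<lambda>t n. t * y n)"
      by (auto simp: into_real_sequences intro!: continuous_intros)
    from openin_continuous_map_preimage[OF continuous_map_compose[OF this q[of 1]] V]
    have "open {t. (\<lambda>n. sin (t * y n)) \<in> V}" by (simp add: comp_def)
    moreover have "0 \<in> {t. (\<lambda>n. sin (t * y n)) \<in> V}" using V0 by (simp add: zero_fun_def)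
    ultimately have "eventually (\<lambda>t. t \<in> {t. (\<lambda>n. sin (t * y n)) \<in> V} \<and> t \<noteq> 0) (at 0)"
      unfolding eventually_at_topological by blast
    then have "eventually (\<lambda>t. (h (\<phi> 0 + t *\<^sub>R w t) n - h (\<phi> 0) n) / t = sin (t * y n) / t) (at 0)"
      by eventually_elim (auto simp: w_def h V0)
    then have "((\<lambda>t. sin (t * y n) / t) \<longlongrightarrow> A (\<phi> 0) (B y) n) (at 0)"
      by (rule tendsto_cong[THEN iffD1, OF _ 1])
    moreover have "DERIV (\<lambda>t. sin (t * y n)) 0 :> y n"
      by (auto intro!: derivative_eq_intros)
    then have "((\<lambda>t. sin (t * y n) / t) \<longlongrightarrow> y n) (at 0)" by (simp add: DERIV_def)
    ultimately show ?thesis by (rule LIM_unique)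
  qed

  have add: "continuous_map (prod_topology E E) E (\<lambda>(x, y). x + y)" using E by (simp add: lc_space_def)
  have trans: "continuous_map X E (\<lambda>x. a + g x)"
    if "a \<in> topspace E" "continuous_map X E g" for X :: "'c topology" and a g
    using continuous_map_compose[OF continuous_map_pairedI[OF _ that(2)] add, of "\<lambda>_. a"] that(1)
    by (simp add: comp_def)
  have \<phi>0: "\<phi> 0 \<in> topspace E" using UE V0 by blast
  \<comment> \<open>Pulling the compact pieces back along \<open>y \<mapsto> \<phi> 0 + B y\<close>
    gives closed sets covering a neighbourhood of \<open>0\<close>.\<close>
  define L where "L K = {y. \<phi> 0 + B y \<in> \<phi> ` K}" for K
  have "real_sequences interior_of \<Union>(L ` \<K>) = {}"
  proof (rule Baire_real_sequences)
    show "countable (L ` \<K>)" using \<open>countable \<K>\<close> by simp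
  next
    fix L' assume "L' \<in> L ` \<K>"
    then obtain K where K': "K \<in> \<K>" "L' = L K" by blast
    have "closedin E (\<phi> ` K)" by (rule compactin_imp_closedin[OF HE \<phi>K[OF K'(1)]])
    from closedin_continuous_map_preimage[OF trans[OF \<phi>0 cB] this]
    show "closedin real_sequences L'" by (simp add: K' L_def)
  next
    fix L' n assume "L' \<in> L ` \<K>"
    then obtain K where K': "K \<in> \<K>" "L' = L K" by blast
    \<comment> \<open>For \<open>z = \<phi> 0 + B y\<close>, \<open>AB\<close> recovers
      \<open>y n\<close> as \<open>A (\<phi> 0) (- \<phi> 0 + z) n\<close>. This is continuous in
      \<open>z\<close>, which ranges over a compact set.\<close>
    have "- \<phi> 0 \<in> topspace E" using subspace_neg[OF subE \<phi>0] .
    from trans[OF this continuous_map_id[unfolded id_def]]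
    have "continuous_map E (prod_topology (subtopology E (\<phi> ` V)) E) (\<lambda>z. (\<phi> 0, - \<phi> 0 + z))"
      unfolding continuous_map_paired using V0 \<phi>0 by simp
    from continuous_map_compose[OF this cA[of n]]
    have "continuous_map E euclideanreal (\<lambda>z. A (\<phi> 0) (- \<phi> 0 + z) n)" by (simp add: comp_def)
    from image_compactin[OF \<phi>K[OF K'(1)] this]
    have "bounded ((\<lambda>z. A (\<phi> 0) (- \<phi> 0 + z) n) ` \<phi> ` K)"
      by (simp add: compact_imp_bounded)
    moreover have "(\<lambda>y. y n) ` L' \<subseteq> (\<lambda>z. A (\<phi> 0) (- \<phi> 0 + z) n) ` \<phi> ` K"
    proof
      fix c assume "c \<in> (\<lambda>y. y n) ` L'"
      then obtain y where y: "\<phi> 0 + B y \<in> \<phi> ` K" "c = y n" by (auto simp: K' L_def)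
      then have "c = A (\<phi> 0) (- \<phi> 0 + (\<phi> 0 + B y)) n" by (simp add: AB)
      with y(1) show "c \<in> (\<lambda>z. A (\<phi> 0) (- \<phi> 0 + z) n) ` \<phi> ` K" by (rule rev_image_eqI)
    qed
    ultimately show "bounded ((\<lambda>y. y n) ` L')" by (rule bounded_subset)
  qed
  moreover have "\<Union>(L ` \<K>) = {y. \<phi> 0 + B y \<in> \<phi> ` V}" unfolding L_def UnK[symmetric] by blast
  moreover have "openin real_sequences {y. \<phi> 0 + B y \<in> \<phi> ` V}"
    using openin_continuous_map_preimage[OF trans[OF \<phi>0 cB] U] by simp
  ultimately have "{y. \<phi> 0 + B y \<in> \<phi> ` V} = {}" by (simp add: interior_of_openin)
  moreover have "0 \<in> {y. \<phi> 0 + B y \<in> \<phi> ` V}" using V0 B0 by simp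
  ultimately show False by blast
qed

theorem theorem1p3:
  shows "(\<forall>k::enat. k \<noteq> 0 \<longrightarrow>
            \<not> Ck_initial_submanifold TYPE('u::real_vector \<times> (nat \<Rightarrow> real)) TYPE('e::real_vector)
                k seq_mfd bounded_sequences) \<and>
         \<not> initial_Lie_subgroup TYPE('u \<times> (nat \<Rightarrow> real)) TYPE('e)
              seq_group seq_mfd bounded_sequences"
proof (intro conjI allI impI notI)
  fix k :: enat
  assume "k \<noteq> 0" "Ck_initial_submanifold TYPE('u \<times> (nat \<Rightarrow> real)) TYPE('e) k seq_mfd bounded_sequences"
  then show False
    unfolding Ck_initial_submanifold_def using bounded_sequences_not_initial by blast
next
  assume "initial_Lie_subgroup TYPE('u \<times> (nat \<Rightarrow> real)) TYPE('e) seq_group seq_mfd bounded_sequences"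
  then obtain S :: "(nat \<Rightarrow> real, 'e) mfd" where S: "Lie_group (seq_group\<lparr>carrier := bounded_sequences\<rparr>) S"
      "\<And>k. k \<noteq> 0 \<Longrightarrow> Ck_initial_structure TYPE('u \<times> (nat \<Rightarrow> real)) k seq_mfd S"
    unfolding initial_Lie_subgroup_def by blast
  from S(1) have "topspace (mtop S) = bounded_sequences" by (simp add: Lie_group_def)
  \<comment> \<open>A Lie subgroup structure is initial for all nonzero \<open>k\<close>
    simultaneously; \<open>k = 1\<close> is picked.\<close>
  from bounded_sequences_not_initial[OF S(2)[of 1] this] show False by simp
qed

end
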